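(* Let $G=HV\leqslant \mathrm{AGL}(V)$ be a finite affine primitive permutation group with point stabilizer $H=G_0$ (the stabilizer of the zero vector) and socle $V=(\mathbb{Z}_p)^k$, where $p$ is a prime and $k\geqslant 1$. Let $r$ be a prime. Then every derangement in $G$ has order $r$ if and only if $r=p$ and the following two conditions hold: (i) every two-point stabilizer in $G$ is an $r$-group; (ii) a Sylow $r$-subgroup of $G$ has exponent $r$.
   Context: A derangement in a permutation group is an element with no fixed points (here, on the set $V$). A two-point stabilizer is the pointwise stabilizer in $G$ of two distinct points. The trivial group is regarded as an $r$-group. *)

theory Defs
  imports
    "HOL-Analysis.Cartesian_Space"
    "HOL-Algebra.Group_Action"
    "HOL-Algebra.Generated_Groups"
    "HOL-Algebra.Multiplicative_Group"
    "Berlekamp_Zassenhaus.Finite_Field"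
begin

section \<open>Permutation groups\<close>

text \<open>A set of permutations of a whole type, regarded as a group under composition.\<close>

abbreviation perm_group :: "('a \<Rightarrow> 'a) set \<Rightarrow> ('a \<Rightarrow> 'a) monoid" where
  "perm_group G \<equiv> (BijGroup UNIV)\<lparr>carrier := G\<rparr>"

definition block :: "('g, 'm) monoid_scheme \<Rightarrow> 'a set \<Rightarrow> ('g \<Rightarrow> 'a \<Rightarrow> 'a) \<Rightarrow> 'a set \<Rightarrow> bool" where
  "block G E \<phi> B \<longleftrightarrow>
     B \<subseteq> E \<and> B \<noteq> {} \<and> (\<forall>g\<in>carrier G. \<phi> g ` B = B \<or> \<phi> g ` B \<inter> B = {})"

locale primitive_action = transitive_action +
  assumes trivial_blocks: "block G E \<phi> B \<Longrightarrow> (\<exists>x. B = {x}) \<or> B = E"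

definition derangement :: "'a set \<Rightarrow> ('g \<Rightarrow> 'a \<Rightarrow> 'a) \<Rightarrow> 'g \<Rightarrow> bool" where
  "derangement E \<phi> g \<longleftrightarrow> (\<forall>x\<in>E. \<phi> g x \<noteq> x)"


section \<open>Finite groups\<close>

definition minimal_normal :: "('g, 'm) monoid_scheme \<Rightarrow> 'g set \<Rightarrow> bool" where
  "minimal_normal G N \<longleftrightarrow>
     N \<lhd> G \<and> N \<noteq> {\<one>\<^bsub>G\<^esub>} \<and> (\<forall>M. M \<lhd> G \<and> M \<subseteq> N \<longrightarrow> M = {\<one>\<^bsub>G\<^esub>} \<or> M = N)"

definition socle :: "('g, 'm) monoid_scheme \<Rightarrow> 'g set" where
  "socle G = generate G (\<Union>{N. minimal_normal G N})"

text \<open>The exponent \<open>n = 0\<close> is allowed, so the trivial group is an \<open>r\<close>-group.\<close>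

definition r_group :: "nat \<Rightarrow> ('g, 'm) monoid_scheme \<Rightarrow> bool" where
  "r_group r G \<longleftrightarrow> group G \<and> (\<exists>n. Coset.order G = r ^ n)"

definition sylow_subgroup :: "nat \<Rightarrow> ('g, 'm) monoid_scheme \<Rightarrow> 'g set \<Rightarrow> bool" where
  "sylow_subgroup r G P \<longleftrightarrow> subgroup P G \<and> card P = r ^ multiplicity r (Coset.order G)"

text \<open>Only meaningful if some positive power kills \<open>G\<close>, for instance if \<open>G\<close> is finite.\<close>

definition group_exponent :: "('g, 'm) monoid_scheme \<Rightarrow> nat" where
  "group_exponent G = (LEAST n. 0 < n \<and> (\<forall>x\<in>carrier G. x [^]\<^bsub>G\<^esub> n = \<one>\<^bsub>G\<^esub>))"


section \<open>The affine group\<close>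

definition translation_group :: "('f::field ^ 'k \<Rightarrow> 'f ^ 'k) set" where
  "translation_group = {t. \<exists>b. t = (\<lambda>v. v + b)}"

definition AGL :: "('f::field ^ 'k \<Rightarrow> 'f ^ 'k) set" where
  "AGL = {f. \<exists>A b. invertible A \<and> f = (\<lambda>v. A *v v + b)}"

lemma AGL_subgroup: "subgroup (AGL :: ('f::field ^ 'k \<Rightarrow> 'f ^ 'k) set) (BijGroup UNIV)"
proof -
  have bij: "f \<in> Bij UNIV" if fA: "f \<in> AGL" for f :: "'f ^ 'k \<Rightarrow> 'f ^ 'k"
  proof -
    obtain A B :: "'f ^ 'k ^ 'k" and b where A: "A ** B = mat 1" "B ** A = mat 1"
      and f: "f = (\<lambda>v. A *v v + b)"
      using fA unfolding AGL_def invertible_def by blast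
    have "bij f"
      by (rule o_bij[of "\<lambda>w. B *v (w - b)"])
        (auto simp: f fun_eq_iff A matrix_vector_mul_assoc)
    then show ?thesis by (simp add: Bij_def)
  qed
  interpret group "BijGroup (UNIV :: ('f ^ 'k) set)" by (rule group_BijGroup)
  show ?thesis
  proof (rule subgroupI)
    show "(AGL :: ('f ^ 'k \<Rightarrow> 'f ^ 'k) set) \<subseteq> carrier (BijGroup UNIV)"
      using bij by (auto simp: BijGroup_def)
    have "(\<lambda>v. mat 1 *v v + 0) \<in> (AGL :: ('f ^ 'k \<Rightarrow> 'f ^ 'k) set)"
      unfolding AGL_def invertible_def using matrix_mul_lid[of "mat 1 :: 'f ^ 'k ^ 'k"] by blast
    then show "(AGL :: ('f ^ 'k \<Rightarrow> 'f ^ 'k) set) \<noteq> {}" by blast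
  next
    fix f :: "'f ^ 'k \<Rightarrow> 'f ^ 'k" assume fA: "f \<in> AGL"
    obtain A B :: "'f ^ 'k ^ 'k" and b where A: "A ** B = mat 1" "B ** A = mat 1"
      and f: "f = (\<lambda>v. A *v v + b)"
      using fA unfolding AGL_def invertible_def by blast
    define g where "g = (\<lambda>w. B *v w + - (B *v b))"
    have g: "g \<in> AGL" using A unfolding AGL_def invertible_def g_def by blast
    have "g \<otimes>\<^bsub>BijGroup UNIV\<^esub> f = \<one>\<^bsub>BijGroup UNIV\<^esub>"
      using bij[OF g] bij[OF fA]
      by (auto simp: BijGroup_def compose_def g_def f fun_eq_iff A matrix_vector_mul_assoc
          matrix_vector_right_distrib)
    then have "inv\<^bsub>BijGroup UNIV\<^esub> f = g"
      using bij[OF g] bij[OF fA] by (intro inv_equality) (auto simp: BijGroup_def)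
    with g show "inv\<^bsub>BijGroup UNIV\<^esub> f \<in> AGL" by simp
  next
    fix f g :: "'f ^ 'k \<Rightarrow> 'f ^ 'k" assume fA: "f \<in> AGL" and gA: "g \<in> AGL"
    obtain A B :: "'f ^ 'k ^ 'k" and a b where A: "invertible A" "invertible B"
      and fg: "f = (\<lambda>v. A *v v + a)" "g = (\<lambda>v. B *v v + b)"
      using fA gA unfolding AGL_def by blast
    have "f \<otimes>\<^bsub>BijGroup UNIV\<^esub> g = (\<lambda>v. (A ** B) *v v + (A *v b + a))"
      using bij[OF fA] bij[OF gA]
      by (auto simp: BijGroup_def compose_def fg fun_eq_iff matrix_vector_mul_assoc
          matrix_vector_right_distrib)
    then show "f \<otimes>\<^bsub>BijGroup UNIV\<^esub> g \<in> AGL"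
      using invertible_mult[OF A] unfolding AGL_def by blast
  qed
qed

end

theory Submission
  imports Defs "HOL-Algebra.Sylow" "HOL-Combinatorics.Cycles"
begin

text \<open>
  Nonzero translations are derangements of order \<open>p\<close>, which
  forces \<open>r = p\<close>. For \<open>g v = A v + b\<close> the point is that some \<open>A w + c\<close> has no fixed point iff
  \<open>A - 1\<close> is not surjective iff \<open>A\<close> fixes a nonzero vector, and by counting orbits on \<open>V\<close> this holds
  whenever \<open>A\<close> has \<open>p\<close>-power order.

  If all derangements have order \<open>p\<close>: an element of prime order \<open>s \<noteq> p\<close> fixing \<open>x \<noteq> y\<close>, composed
  with the translation by \<open>y - x\<close> (with which it commutes), is a derangement whose order is not \<open>p\<close>;
  and a \<open>p\<close>-element \<open>A v + b\<close> with a fixed point has the order of \<open>A\<close>, which divides the order \<open>p\<close> of a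
  derangement \<open>A v + c\<close>. Conversely, the linear part of a derangement fixes \<open>0\<close> and a nonzero
  vector, hence is a \<open>p\<close>-element by (i); so the derangement is a \<open>p\<close>-element, conjugate into a given
  Sylow subgroup, and (ii) applies.
\<close>

section \<open>Counting moved points\<close>

text \<open>The moved points are partitioned by the nontrivial cycles of \<open>f\<close>. Each
  cycle length divides \<open>p ^ n\<close> and exceeds 1, so it is a multiple of
  \<open>p\<close>.\<close>

lemma prime_dvd_card_moved:
  assumes p: "prime p" and fin: "finite {x. f x \<noteq> x}" and f: "f ^^ (p ^ n) = id"
  shows "p dvd card {x. f x \<noteq> x}"
proof -
  have "p ^ n > 0" using p prime_gt_0_nat by simp
  then obtain m where m: "p ^ n = Suc m" using gr0_implies_Suc by blast
  have "bij f"
    using f by (intro o_bij[of "f ^^ m"]) (simp_all add: m funpow_Suc_right[symmetric])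
  then have perm: "permutation f" using fin by (simp add: permutation)
  let ?C = "{set (support f a) |a. f a \<noteq> a}"
  have cov: "\<Union>?C = {x. f x \<noteq> x}" by (rule support_coverture[OF perm])
  have "p dvd card (\<Union>?C)"
  proof (rule dvd_partition)
    show "finite (\<Union>?C)" using fin unfolding cov .
    show "\<forall>c\<in>?C. p dvd card c"
    proof
      fix c assume "c \<in> ?C"
      then obtain a where a: "f a \<noteq> a" "c = set (support f a)" by blast
      have "card c = length (support f a)"
        unfolding a(2) by (rule distinct_card[OF cycle_of_permutation[OF perm]])
      then have c: "card c = least_power f a" by simp
      have "least_power f a dvd p ^ n" using f by (intro least_power_minimal) simp
      then obtain j where j: "least_power f a = p ^ j" using divides_primepow_nat[OF p] by blast
      have "j \<noteq> 0" using least_power_gt_one[OF perm a(1)] j by (metis One_nat_def less_irrefl power_0)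
      then show "p dvd card c" using c j by (simp add: dvd_power)
    qed
    show "\<forall>c1\<in>?C. \<forall>c2\<in>?C. c1 \<noteq> c2 \<longrightarrow> c1 \<inter> c2 = {}"
      using disjoint_support[OF perm] unfolding disjoint_def by blast
  qed
  then show ?thesis unfolding cov .
qed

section \<open>Sylow subgroups and groups of prime power order\<close>

context group
begin

text \<open>
  Right multiplication by \<open>x\<close> permutes the right cosets of \<open>P\<close>, whose number is prime to \<open>p\<close>,
  so it fixes some coset \<open>P y\<close>.
\<close>

lemma conjugate_in_sylow_subgroup:
  assumes p: "prime p" and fin: "finite (carrier G)" and P: "sylow_subgroup p G P"
    and x: "x \<in> carrier G" and xn: "x [^] (p ^ n) = \<one>"
  shows "\<exists>y\<in>carrier G. y \<otimes> x \<otimes> inv y \<in> P"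
proof -
  have sub: "subgroup P G" and card: "card P = p ^ multiplicity p (Coset.order G)"
    using P unfolding sylow_subgroup_def by auto
  have o: "Coset.order G \<noteq> 0" using fin order_gt_0_iff_finite by simp
  \<comment> \<open>Extending by the identity outside the cosets makes \<open>f\<close> a map on a
    whole type, as \<open>prime_dvd_card_moved\<close> requires, without adding moved
    points.\<close>
  define f where "f = (\<lambda>C. if C \<in> rcosets P then C #> x else C)"
  have closed: "C #> y \<in> rcosets P" if "C \<in> rcosets P" "y \<in> carrier G" for C y
    using that subgroup.subset[OF sub]
    by (auto simp: RCOSETS_def coset_mult_assoc)
  have subs: "C \<subseteq> carrier G" if "C \<in> rcosets P" for C
    using that by (rule rcosets_subset_PowG[OF sub, THEN subsetD, THEN PowD])
  have pow: "(f ^^ m) C = C #> (x [^] m)" if C: "C \<in> rcosets P" for C m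
  proof (induction m)
    case 0
    show ?case using subs[OF C] by (simp add: coset_mult_one)
  next
    case (Suc m)
    have "C #> (x [^] m) \<in> rcosets P" using closed[OF C] x by simp
    then show ?case using Suc x subs[OF C] by (simp add: f_def coset_mult_assoc)
  qed
  have out: "(f ^^ m) C = C" if "C \<notin> rcosets P" for C m
    by (induction m) (use that in \<open>auto simp: f_def\<close>)
  have f: "f ^^ (p ^ n) = id"
  proof
    fix C
    show "(f ^^ (p ^ n)) C = id C"
      using pow[of C "p ^ n"] out[of C "p ^ n"] subs[of C]
      by (cases "C \<in> rcosets P") (simp_all add: xn coset_mult_one)
  qed
  have moved: "{C. f C \<noteq> C} \<subseteq> rcosets P" by (auto simp: f_def)
  have finR: "finite (rcosets P)"
    using rcosets_subset_PowG[OF sub] fin by (meson finite_Pow_iff finite_subset)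
  have "{C. f C \<noteq> C} \<noteq> rcosets P"
  proof
    assume eq: "{C. f C \<noteq> C} = rcosets P"
    have "p dvd card {C. f C \<noteq> C}"
      by (rule prime_dvd_card_moved[OF p _ f]) (simp add: eq finR)
    \<comment> \<open>By Lagrange, an index divisible by \<open>p\<close> would give the group order
      one more factor \<open>p\<close> than its multiplicity allows.\<close>
    then have "p ^ Suc (multiplicity p (Coset.order G)) dvd card (rcosets P) * card P"
      unfolding eq card by (simp add: mult_dvd_mono)
    then have "p ^ Suc (multiplicity p (Coset.order G)) dvd Coset.order G"
      using lagrange[OF sub] by simp
    then have "Suc (multiplicity p (Coset.order G)) \<le> multiplicity p (Coset.order G)"
      using o p by (intro multiplicity_geI) auto
    then show False by simp
  qed
  then obtain C where C: "C \<in> rcosets P" "f C = C" using moved by blast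
  then obtain y where y: "y \<in> carrier G" "C = P #> y" unfolding RCOSETS_def by blast
  have "P #> (y \<otimes> x) = P #> y"
    using C x y subgroup.subset[OF sub] by (simp add: f_def coset_mult_assoc)
  moreover have "y \<otimes> x \<in> P #> (y \<otimes> x)" using x y sub by (simp add: rcos_self)
  ultimately obtain h where h: "h \<in> P" "y \<otimes> x = h \<otimes> y" unfolding r_coset_def by auto
  have "y \<otimes> x \<otimes> inv y = h"
    using h y subgroup.mem_carrier[OF sub] by (simp add: m_assoc)
  with h y show ?thesis by blast
qed

lemma conj_pow:
  assumes "x \<in> carrier G" "y \<in> carrier G"
  shows "(y \<otimes> x \<otimes> inv y) [^] (n::nat) = y \<otimes> x [^] n \<otimes> inv y"
proof (induction n)
  case (Suc n)
  then show ?case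
    using assms by (simp add: m_assoc inv_solve_left')
qed (use assms in simp)

lemma ex_sylow_subgroup:
  assumes "prime p" "finite (carrier G)"
  shows "\<exists>P. sylow_subgroup p G P"
  unfolding sylow_subgroup_def
  using sylow_thm[OF assms(1) is_group _ assms(2)] multiplicity_dvd[of p "Coset.order G"]
  by (metis dvd_def)

text \<open>Some conjugate of \<open>x\<close> lies in \<open>P\<close>, and conjugation commutes
  with powers, so killing the elements of one Sylow subgroup kills all
  \<open>p\<close>-elements.\<close>

lemma p_element_power_eq_one:
  assumes p: "prime p" and fin: "finite (carrier G)" and P: "sylow_subgroup p G P"
    and kill: "\<And>y. y \<in> P \<Longrightarrow> y [^] p = \<one>"
    and x: "x \<in> carrier G" and xn: "x [^] (p ^ n) = \<one>"
  shows "x [^] p = \<one>"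
proof -
  obtain y where y: "y \<in> carrier G" "y \<otimes> x \<otimes> inv y \<in> P"
    using conjugate_in_sylow_subgroup[OF p fin P x xn] by blast
  then have "y \<otimes> x [^] p \<otimes> inv y = \<one>" using kill x by (metis conj_pow)
  then have "y \<otimes> x [^] p = y"
    using x y by (metis inv_closed inv_inv inv_equality m_closed nat_pow_closed)
  then show ?thesis using x y by (simp add: r_cancel_one)
qed

text \<open>The assumption \<open>dvd\<close> excludes the trivial \<open>P\<close>, whose exponent
  is 1. A nontrivial element of \<open>P\<close> killed by \<open>p\<close> has order exactly
  \<open>p\<close>, so no smaller positive exponent works.\<close>

lemma sylow_exponent_prime_iff:
  assumes p: "prime p" and fin: "finite (carrier G)" and P: "sylow_subgroup p G P"
    and dvd: "p dvd Coset.order G"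
  shows "group_exponent (G\<lparr>carrier := P\<rparr>) = p \<longleftrightarrow> (\<forall>x\<in>P. x [^] p = \<one>)"
proof -
  have sub: "subgroup P G" and card: "card P = p ^ multiplicity p (Coset.order G)"
    using P unfolding sylow_subgroup_def by auto
  have o: "Coset.order G \<noteq> 0" using fin order_gt_0_iff_finite by simp
  let ?Q = "\<lambda>n::nat. 0 < n \<and> (\<forall>x\<in>P. x [^] n = \<one>)"
  have exp: "group_exponent (G\<lparr>carrier := P\<rparr>) = (LEAST n. ?Q n)"
    unfolding group_exponent_def by (simp add: nat_pow_consistent[symmetric])
  have finP: "finite P" using fin sub finite_subset subgroup.subset by blast
  have one: "\<one> \<in> P" using sub by (rule subgroup.one_closed)
  show ?thesis
  proof
    assume "group_exponent (G\<lparr>carrier := P\<rparr>) = p"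
    \<comment> \<open>The group order witnesses that some positive exponent exists, so
      \<open>LEAST\<close> really has the property.\<close>
    moreover have "?Q (Coset.order G)" using o sub fin by (auto intro: pow_order_eq_1 subgroup.mem_carrier)
    then have "?Q (LEAST n. ?Q n)" by (rule LeastI[of ?Q])
    ultimately show "\<forall>x\<in>P. x [^] p = \<one>" unfolding exp by simp
  next
    assume kill: "\<forall>x\<in>P. x [^] p = \<one>"
    have "multiplicity p (Coset.order G) > 0"
      using p o dvd by (simp add: prime_multiplicity_gt_zero_iff)
    then have "card P > 1" unfolding card using p by (metis one_less_power prime_gt_1_nat)
    then have "P \<noteq> {\<one>}" by auto
    then obtain x where x: "x \<in> P" "x \<noteq> \<one>" using one by blast
    have xG: "x \<in> carrier G" using x sub by (auto intro: subgroup.mem_carrier)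
    have "ord x dvd p" using kill x pow_eq_id[OF xG, of p] by blast
    then have ordx: "ord x = p"
      using p x xG by (metis ord_eq_1 prime_nat_iff)
    have "(LEAST n. ?Q n) = p"
    proof (rule Least_equality)
      show "?Q p" using kill p by (simp add: prime_gt_0_nat)
      fix n assume "?Q n"
      then have "ord x dvd n" "n > 0" using x pow_eq_id[OF xG, of n] by blast+
      then show "p \<le> n" unfolding ordx by (rule dvd_imp_le)
    qed
    then show "group_exponent (G\<lparr>carrier := P\<rparr>) = p" unfolding exp .
  qed
qed

text \<open>By Cauchy's theorem, any prime \<open>s\<close> dividing the order yields a nontrivial
  element killed by \<open>s\<close>; hence \<open>p\<close> is the only prime divisor.\<close>

lemma r_group_if_no_other_prime_order:
  assumes p: "prime p" and fin: "finite (carrier G)"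
    and no: "\<And>s x. prime s \<Longrightarrow> s \<noteq> p \<Longrightarrow> x \<in> carrier G \<Longrightarrow> x [^] s = \<one> \<Longrightarrow> x = \<one>"
  shows "r_group p G"
proof -
  have o: "Coset.order G \<noteq> 0" using fin order_gt_0_iff_finite by simp
  have only: "s = p" if s: "prime s" "s dvd Coset.order G" for s
  proof (rule ccontr)
    assume "s \<noteq> p"
    \<comment> \<open>Cauchy's theorem comes from \<open>sylow_thm\<close> with exponent 1: the
      cofactor \<open>m\<close> may still be divisible by \<open>s\<close>.\<close>
    obtain m where "Coset.order G = s ^ 1 * m" using s by auto
    then obtain K where K: "subgroup K G" "card K = s ^ 1"
      using sylow_thm[OF s(1) is_group _ fin] by blast
    have "K \<noteq> {\<one>}" using K s by (auto dest: prime_gt_1_nat)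
    then obtain x where x: "x \<in> K" "x \<noteq> \<one>" using K subgroup.one_closed by blast
    interpret K: group "G\<lparr>carrier := K\<rparr>" using K subgroup_imp_group by blast
    have "x [^]\<^bsub>G\<lparr>carrier := K\<rparr>\<^esub> Coset.order (G\<lparr>carrier := K\<rparr>) = \<one>\<^bsub>G\<lparr>carrier := K\<rparr>\<^esub>"
      using x by (intro K.pow_order_eq_1) simp
    then have "x [^] s = \<one>" using K by (simp add: Coset.order_def nat_pow_consistent[symmetric])
    then show False using no[OF s(1) \<open>s \<noteq> p\<close>] x K subgroup.mem_carrier by metis
  qed
  have "\<exists>n. Coset.order G = p ^ n"
  proof (cases "Coset.order G = 1")
    case True
    then show ?thesis by (metis power_0)
  next
    case False
    obtain x where x: "Coset.order G = p ^ multiplicity p (Coset.order G) * x" "\<not> p dvd x"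
      using multiplicity_decompose'[OF o, of p] p not_prime_unit by blast
    have "x = 1"
    proof (rule ccontr)
      assume "x \<noteq> 1"
      then obtain s where "prime s" "s dvd x" using prime_factor_nat by blast
      moreover from this have "s = p" using only x(1) by (metis dvd_mult)
      ultimately show False using x(2) by blast
    qed
    then show ?thesis using x by auto
  qed
  then show ?thesis unfolding r_group_def using is_group by blast
qed

end

section \<open>Affine maps over a prime field\<close>

text \<open>Translation parts cancel in differences, so iterates of affine maps can be compared
  through the linear part alone.\<close>

lemma affine_funpow_diff:
  fixes A :: "'f::field ^ 'k ^ 'k"
  assumes "f = (\<lambda>v. A *v v + b)"
  shows "(f ^^ n) u - (f ^^ n) w = (((*v) A) ^^ n) (u - w)"
proof (induction n)
  case (Suc n)
  have f: "f v = A *v v + b" for v by (simp add: assms)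
  have "(f ^^ Suc n) u - (f ^^ Suc n) w = A *v ((f ^^ n) u - (f ^^ n) w)"
    by (simp add: f matrix_vector_mult_diff_distrib)
  also have "\<dots> = (((*v) A) ^^ Suc n) (u - w)" by (simp only: Suc funpow.simps comp_apply)
  finally show ?case .
qed simp

lemma translation_funpow: "((\<lambda>w. w + c) ^^ n) w = w + of_nat n *s (c :: 'f::field ^ 'k)"
  by (induction n) (simp_all add: vector_sadd_rdistrib algebra_simps)

lemma translation_funpow_char:
  "(\<lambda>w. w + c) ^^ CARD('p) = (id :: 'p::prime_card mod_ring ^ 'k \<Rightarrow> _)"
  by (rule ext) (simp add: translation_funpow)

text \<open>The assumption makes \<open>g ^^ m\<close> a translation, whose \<open>p\<close>-th
  iterate is trivial in characteristic \<open>p\<close>.\<close>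

lemma translation_power_char:
  fixes g :: "'p::prime_card mod_ring ^ 'k \<Rightarrow> 'p mod_ring ^ 'k"
  assumes diff: "\<And>u w. (g ^^ m) u - (g ^^ m) w = u - w"
  shows "g ^^ (m * CARD('p)) = id"
proof -
  define c where "c = (g ^^ m) 0"
  have "(g ^^ m) w = w + c" for w using diff[of w 0] by (simp add: c_def diff_eq_eq)
  then have "g ^^ m = (\<lambda>w. w + c)" by (rule ext)
  then have "(g ^^ m) ^^ CARD('p) = id" by (simp only: translation_funpow_char)
  then show ?thesis by (simp add: funpow_mult mult.commute)
qed

text \<open>The left side says that \<open>w - A *v w\<close> is not injective in \<open>w\<close>,
  the right side that it is not surjective; on a finite space these agree.\<close>

lemma ex_fixed_vector_iff:
  fixes A :: "'p::prime_card mod_ring ^ 'k ^ 'k"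
  shows "(\<exists>v. v \<noteq> 0 \<and> A *v v = v) \<longleftrightarrow> (\<exists>b. \<forall>w. A *v w + b \<noteq> w)"
proof -
  let ?N = "\<lambda>w. w - A *v w"
  have "(\<exists>v. v \<noteq> 0 \<and> A *v v = v) \<longleftrightarrow> \<not> inj ?N"
  proof
    assume "\<exists>v. v \<noteq> 0 \<and> A *v v = v"
    then obtain v where v: "v \<noteq> 0" "A *v v = v" by blast
    then have "?N v = ?N 0" by simp
    then show "\<not> inj ?N" using v(1) by (metis injD)
  next
    assume "\<not> inj ?N"
    then obtain u w where uw: "?N u = ?N w" "u \<noteq> w" unfolding inj_def by blast
    then have "A *v (u - w) = u - w" by (simp add: matrix_vector_mult_diff_distrib algebra_simps)
    then show "\<exists>v. v \<noteq> 0 \<and> A *v v = v" using uw(2) by (intro exI[of _ "u - w"]) simp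
  qed
  also have "\<dots> \<longleftrightarrow> \<not> surj ?N"
    using finite_UNIV_inj_surj[of ?N] finite_UNIV_surj_inj[of ?N] by auto
  also have "\<dots> \<longleftrightarrow> (\<exists>b. \<forall>w. b \<noteq> ?N w)" unfolding surj_def by blast
  also have "\<dots> \<longleftrightarrow> (\<exists>b. \<forall>w. A *v w + b \<noteq> w)"
    by (metis add.commute add_diff_cancel_left' diff_add_cancel)
  finally show ?thesis .
qed

text \<open>Otherwise exactly \<open>|V| - 1\<close> vectors are moved, a number divisible by
  \<open>p\<close> by the cycle count, although \<open>|V|\<close> is a positive power of
  \<open>p\<close>.\<close>

lemma p_power_order_fixes_vector:
  fixes A :: "'p::prime_card mod_ring ^ 'k ^ 'k"
  assumes A: "((*v) A) ^^ (CARD('p) ^ n) = id"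
  shows "\<exists>v. v \<noteq> 0 \<and> A *v v = v"
proof (rule ccontr)
  assume "\<not> ?thesis"
  then have "{v. A *v v \<noteq> v} = UNIV - {0}" by auto
  then have "CARD('p) dvd CARD('p mod_ring ^ 'k) - 1"
    using prime_dvd_card_moved[OF prime_card _ A] by (simp add: card_Diff_singleton)
  moreover have "CARD('p) dvd CARD('p mod_ring ^ 'k)" by simp
  moreover have "CARD('p mod_ring ^ 'k) \<ge> 1" by (simp add: Suc_le_eq)
  ultimately have "CARD('p) dvd 1" by (metis dvd_diffD1)
  then show False using prime_card[where 'a='p] by (simp add: prime_nat_iff)
qed

section \<open>Groups of affine maps containing all translations\<close>

locale affine_group =
  fixes G :: "('p::prime_card mod_ring ^ 'k \<Rightarrow> 'p mod_ring ^ 'k) set"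
  assumes subgroup_AGL: "subgroup G (perm_group AGL)"
    and translation_subset: "translation_group \<subseteq> G"
begin

lemma affineE:
  assumes "g \<in> G"
  obtains A b where "g = (\<lambda>v. A *v v + b)"
  using subgroup.mem_carrier[OF subgroup_AGL assms] by (auto simp: AGL_def)

sublocale group "perm_group G"
proof -
  have "group (perm_group AGL :: ('p mod_ring ^ 'k \<Rightarrow> 'p mod_ring ^ 'k) monoid)"
    using group.subgroup_imp_group[OF group_BijGroup AGL_subgroup] .
  from group.subgroup_imp_group[OF this subgroup_AGL] show "group (perm_group G)" by simp
qed

lemma Bij: "g \<in> G \<Longrightarrow> g \<in> Bij UNIV"
  using subgroup.mem_carrier[OF subgroup_AGL] subgroup.mem_carrier[OF AGL_subgroup]
  by (fastforce simp: BijGroup_def)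

lemma one_eq [simp]: "\<one>\<^bsub>BijGroup UNIV\<^esub> = id"
  by (auto simp: BijGroup_def)

lemma mult_eq: "f \<in> G \<Longrightarrow> g \<in> G \<Longrightarrow> f \<otimes>\<^bsub>BijGroup UNIV\<^esub> g = f \<circ> g"
  using Bij by (auto simp: BijGroup_def compose_def)

lemma comp_closed: "f \<in> G \<Longrightarrow> g \<in> G \<Longrightarrow> f \<circ> g \<in> G"
  using m_closed[of f g] mult_eq[of f g] by simp

lemma pow_closed: "g \<in> G \<Longrightarrow> g ^^ n \<in> G"
proof (induction n)
  case 0
  show ?case using one_closed by (simp add: id_def)
qed (simp add: comp_closed)

lemma pow_eq: "g \<in> G \<Longrightarrow> g [^]\<^bsub>perm_group G\<^esub> (n::nat) = g ^^ n"
proof (induction n)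
  case (Suc n)
  have "g [^]\<^bsub>perm_group G\<^esub> Suc n = (g ^^ n) \<otimes>\<^bsub>perm_group G\<^esub> g" using Suc by simp
  also have "\<dots> = g ^^ Suc n"
    using Suc.prems by (simp add: mult_eq pow_closed funpow_Suc_right del: funpow.simps(2))
  finally show ?case .
qed simp

lemma translation_mem: "(\<lambda>w. w + c) \<in> G"
  using translation_subset unfolding translation_group_def by blast

lemma translate_mem: "g \<in> G \<Longrightarrow> (\<lambda>w. g w + c) \<in> G"
  using comp_closed[OF translation_mem[of c]] by (simp add: comp_def)

lemma ord_eq_prime:
  assumes "g \<in> G" "g \<noteq> id" "g ^^ r = id" "prime r"
  shows "ord g = r"
  using assms ord_eq_1 pow_eq_id[of g r] by (auto simp: pow_eq prime_nat_iff)

lemma stabilizer_eq: "stabilizer (perm_group G) (\<lambda>g. g) x = {g \<in> G. g x = x}"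
  by (simp add: stabilizer_def)

text \<open>Here \<open>1\<close> is the all-ones vector, a convenient nonzero vector. This
  translation is the derangement that forces \<open>r = p\<close>.\<close>

lemma ord_translation_one: "ord (\<lambda>w. w + 1) = CARD('p)"
proof -
  have "(\<lambda>w :: 'p mod_ring ^ 'k. w + 1) \<noteq> id"
    by (metis add_cancel_left_right id_apply zero_neq_one)
  then show ?thesis
    using ord_eq_prime[OF translation_mem] translation_funpow_char prime_card by blast
qed

lemma CARD_dvd_order: "CARD('p) dvd Coset.order (perm_group G)"
  using ord_dvd_group_order[of "\<lambda>w. w + 1"] translation_mem[of 1] ord_translation_one by simp

lemma derangement_p_power:
  assumes two: "\<And>x y. x \<noteq> y \<Longrightarrow> r_group CARD('p) (perm_group
      (stabilizer (perm_group G) (\<lambda>g. g) x \<inter> stabilizer (perm_group G) (\<lambda>g. g) y))"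
    and g: "g \<in> G" and der: "derangement UNIV (\<lambda>g. g) g"
  shows "\<exists>n. g ^^ (CARD('p) ^ n) = id"
proof -
  obtain A b where A: "g = (\<lambda>v. A *v v + b)" using g by (rule affineE)
  obtain v where v: "v \<noteq> 0" "A *v v = v"
    using der ex_fixed_vector_iff[of A] by (auto simp: A derangement_def)
  let ?K = "stabilizer (perm_group G) (\<lambda>g. g) 0 \<inter> stabilizer (perm_group G) (\<lambda>g. g) v"
  \<comment> \<open>Following \<open>g\<close> by the translation by \<open>- b\<close> leaves its
    linear part.\<close>
  have "(*v) A \<in> G" using translate_mem[OF g, of "- b"] by (simp add: A)
  then have AK: "(*v) A \<in> ?K" using v by (simp add: stabilizer_eq)
  obtain n where K: "group (perm_group ?K)" "Coset.order (perm_group ?K) = CARD('p) ^ n"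
    using two[of 0 v] v(1) unfolding r_group_def by auto
  have "(*v) A [^]\<^bsub>perm_group ?K\<^esub> (CARD('p) ^ n) = \<one>\<^bsub>perm_group ?K\<^esub>"
    using group.pow_order_eq_1[OF K(1), of "(*v) A"] AK K(2) by simp
  then have "((*v) A) ^^ (CARD('p) ^ n) = id"
    using pow_eq[OF \<open>(*v) A \<in> G\<close>]
      monoid.nat_pow_consistent[of "perm_group G" "(*v) A" _ ?K]
    by simp
  \<comment> \<open>With the linear part trivial, this power of \<open>g\<close> is a translation;
    one further factor \<open>p\<close> kills it.\<close>
  then have "(g ^^ (CARD('p) ^ n)) u - (g ^^ (CARD('p) ^ n)) w = u - w" for u w
    by (simp add: affine_funpow_diff[OF A])
  then have "g ^^ (CARD('p) ^ n * CARD('p)) = id" by (rule translation_power_char)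
  then show ?thesis by (metis power_Suc2)
qed

lemma p_element_funpow_eq_id:
  assumes der: "\<And>g. g \<in> G \<Longrightarrow> derangement UNIV (\<lambda>g. g) g \<Longrightarrow> g ^^ CARD('p) = id"
    and g: "g \<in> G" and gn: "g ^^ (CARD('p) ^ n) = id"
  shows "g ^^ CARD('p) = id"
proof (cases "derangement UNIV (\<lambda>g. g) g")
  case True
  then show ?thesis using der g by blast
next
  case False
  then obtain w0 where w0: "g w0 = w0" by (auto simp: derangement_def)
  obtain A b where A: "g = (\<lambda>v. A *v v + b)" using g by (rule affineE)
  have "((*v) A ^^ (CARD('p) ^ n)) u = u" for u
    using affine_funpow_diff[OF A, of "CARD('p) ^ n" u 0] by (simp add: gn)
  then obtain c where c: "\<And>w. A *v w + c \<noteq> w"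
    using p_power_order_fixes_vector[of n A] ex_fixed_vector_iff[of A] by (auto simp: fun_eq_iff)
  \<comment> \<open>\<open>d\<close> has the linear part of \<open>g\<close> but no fixed point, so
    the assumption on derangements applies to it.\<close>
  define d where "d = (\<lambda>w. A *v w + c)"
  have "d \<in> G" using translate_mem[OF g, of "c - b"] by (simp add: A d_def)
  then have d: "d ^^ CARD('p) = id" using der c by (simp add: d_def derangement_def)
  \<comment> \<open>Equal linear parts give equal differences of iterates; the fixed point
    \<open>w0\<close> then turns differences into values.\<close>
  have "(g ^^ CARD('p)) w - (g ^^ CARD('p)) w0 = w - w0" for w
    unfolding affine_funpow_diff[OF A] affine_funpow_diff[OF d_def, symmetric] d by simp
  moreover have "(g ^^ m) w0 = w0" for m by (induction m) (simp_all add: w0)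
  ultimately show ?thesis by (auto simp: fun_eq_iff)
qed

lemma two_point_stabilizer_no_other_prime_order:
  assumes der: "\<And>g. g \<in> G \<Longrightarrow> derangement UNIV (\<lambda>g. g) g \<Longrightarrow> g ^^ CARD('p) = id"
    and a: "a \<in> G" "a x = x" "a y = y" and xy: "x \<noteq> y"
    and s: "prime s" "s \<noteq> CARD('p)" and as: "a ^^ s = id"
  shows "a = id"
proof -
  obtain A b where A: "a = (\<lambda>v. A *v v + b)" using a(1) by (rule affineE)
  define v where "v = y - x"
  have v: "v \<noteq> 0" using xy by (simp add: v_def)
  have "A *v v = v"
    using affine_funpow_diff[OF A, of 1 y x] a by (simp add: v_def)
  \<comment> \<open>Since the linear part fixes \<open>v\<close>, the map \<open>a\<close> commutes
    with translations by multiples of \<open>v\<close>. Hence powers of \<open>d\<close> below split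
    into a power of \<open>a\<close> and a translation.\<close>
  then have av: "a (of_nat n *s v + w) = of_nat n *s v + a w" for w n
    by (simp add: A matrix_vector_right_distrib vector_scalar_commute add_ac)
  define d where "d = (\<lambda>w. a w + v)"
  have dG: "d \<in> G" unfolding d_def using a(1) by (rule translate_mem)
  have dn: "(d ^^ n) w = (a ^^ n) w + of_nat n *s v" for n w
    by (induction n) (simp_all add: d_def av vector_sadd_rdistrib add_ac)
  \<comment> \<open>A fixed point of \<open>d\<close> would give \<open>s\<close> times
    \<open>v\<close> equal to 0, hence \<open>p\<close> dividing \<open>s\<close>.\<close>
  have "d w \<noteq> w" for w
  proof
    assume "d w = w"
    then have "(d ^^ n) w = w" for n by (induction n) simp_all
    then have "of_nat s *s v = 0" using dn[of s w] by (simp add: as)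
    then have "(of_nat s :: 'p mod_ring) = 0" using v by (simp add: vector_mul_eq_0)
    then have "CARD('p) dvd s" by (rule of_nat_0_mod_ring_dvd)
    then show False using s prime_card[where 'a='p] primes_dvd_imp_eq by metis
  qed
  then have "d ^^ CARD('p) = id" using der dG by (simp add: derangement_def)
  \<comment> \<open>The translation part of \<open>d ^^ p\<close> vanishes in characteristic
    \<open>p\<close>, so \<open>a\<close> is killed by both of the distinct primes \<open>p\<close>
    and \<open>s\<close>.\<close>
  then have "a ^^ CARD('p) = id" using dn[of "CARD('p)"] by (simp add: fun_eq_iff)
  then have "ord a dvd CARD('p)" "ord a dvd s"
    using a(1) as pow_eq_id[of a] by (simp_all add: pow_eq)
  then have "ord a = 1"
    using primes_coprime[OF prime_card s(1)] s(2) coprime_common_divisor_nat by blast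
  then show ?thesis using ord_eq_1[of a] a(1) by simp
qed

end

section \<open>The equivalence for affine primitive groups\<close>

theorem theorem5p7:
  fixes G H V :: "('p::prime_card mod_ring ^ 'k \<Rightarrow> 'p mod_ring ^ 'k) set"
    and r :: nat
  assumes "subgroup G (perm_group AGL)"
    and "primitive_action (perm_group G) UNIV (\<lambda>g. g)"
    and "H = stabilizer (perm_group G) (\<lambda>g. g) 0"
    and "V = translation_group"
    and "G = H <#>\<^bsub>perm_group AGL\<^esub> V"
    and "socle (perm_group G) = V"
    and "prime r"
  shows "(\<forall>g\<in>G. derangement UNIV (\<lambda>g. g) g \<longrightarrow> group.ord (perm_group G) g = r) \<longleftrightarrow>
    r = CARD('p) \<and>
    (\<forall>x y. x \<noteq> y \<longrightarrow>
      r_group r (perm_group (stabilizer (perm_group G) (\<lambda>g. g) x \<inter>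
                             stabilizer (perm_group G) (\<lambda>g. g) y))) \<and>
    (\<forall>P. sylow_subgroup r (perm_group G) P \<longrightarrow> group_exponent (perm_group P) = r)"
proof -
  interpret act: primitive_action "perm_group G" UNIV "\<lambda>g. g" by (rule assms(2))
  \<comment> \<open>The factorization \<open>G = HV\<close> with the identity in \<open>H\<close>
    puts every translation into \<open>G\<close>.\<close>
  have "\<one>\<^bsub>perm_group G\<^esub> \<in> H"
    unfolding assms(3) by (rule subgroup.one_closed[OF act.stabilizer_subgroup]) simp
  moreover have "V \<subseteq> AGL"
  proof -
    have "(\<lambda>v. v + b) \<in> AGL" for b :: "'p mod_ring ^ 'k"
      unfolding AGL_def invertible_def using matrix_mul_lid[of "mat 1 :: 'p mod_ring ^ 'k ^ 'k"]
      by (intro CollectI exI[of _ "mat 1"] exI[of _ b]) auto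
    then show ?thesis unfolding assms(4) translation_group_def by blast
  qed
  moreover have "\<one>\<^bsub>perm_group AGL\<^esub> \<otimes>\<^bsub>perm_group AGL\<^esub> v = v" if "v \<in> AGL" for v :: "'p mod_ring ^ 'k \<Rightarrow> _"
    using that group.is_monoid[OF group.subgroup_imp_group[OF group_BijGroup AGL_subgroup]]
    by (intro monoid.l_one) auto
  ultimately have "V \<subseteq> H <#>\<^bsub>perm_group AGL\<^esub> V"
    unfolding set_mult_def by fastforce
  then have "V \<subseteq> G" using assms(5) by simp
  then interpret affine_group G
    using assms(1,4) by (intro affine_group.intro) auto
  let ?S = "\<lambda>x. stabilizer (perm_group G) (\<lambda>g. g) x"
  show ?thesis (is "?L \<longleftrightarrow> ?p \<and> ?two \<and> ?syl")
  proof
    assume L: ?L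
    let ?t = "\<lambda>w :: 'p mod_ring ^ 'k. w + 1"
    have "derangement UNIV (\<lambda>g. g) ?t" by (simp add: derangement_def)
    then have r: "r = CARD('p)" using L translation_mem[of 1] ord_translation_one by metis
    have der: "g ^^ CARD('p) = id" if "g \<in> G" "derangement UNIV (\<lambda>g. g) g" for g
      using pow_ord_eq_1[of g] L that by (simp add: r pow_eq)
    have ?two
    proof (intro allI impI)
      fix x y :: "'p mod_ring ^ 'k" assume xy: "x \<noteq> y"
      let ?K = "?S x \<inter> ?S y"
      have sub: "subgroup ?K (perm_group G)"
        by (intro subgroups_Inter_pair act.stabilizer_subgroup) simp_all
      interpret K: group "perm_group ?K" using subgroup_imp_group[OF sub] by simp
      show "r_group r (perm_group ?K)"
      proof (rule K.r_group_if_no_other_prime_order[OF assms(7)])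
        fix s a
        assume s: "prime s" "s \<noteq> r" and a: "a \<in> carrier (perm_group ?K)"
          and as: "a [^]\<^bsub>perm_group ?K\<^esub> s = \<one>\<^bsub>perm_group ?K\<^esub>"
        have a': "a \<in> G" "a x = x" "a y = y" using a by (auto simp: stabilizer_eq)
        have "a ^^ s = id"
          using as nat_pow_consistent[of a s ?K] by (simp add: pow_eq a')
        then show "a = \<one>\<^bsub>perm_group ?K\<^esub>"
          using two_point_stabilizer_no_other_prime_order[OF der a' xy] s r by simp
      qed simp
    qed
    moreover have ?syl
    proof (intro allI impI)
      fix P assume P: "sylow_subgroup r (perm_group G) P"
      then have sub: "subgroup P (perm_group G)" and card: "\<exists>n. card P = r ^ n"
        unfolding sylow_subgroup_def by auto
      interpret P: group "perm_group P" using subgroup_imp_group[OF sub] by simp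
      have "x ^^ r = id" if x: "x \<in> P" for x
      proof -
        have xG: "x \<in> G" using subgroup.mem_carrier[OF sub x] by simp
        obtain n where n: "card P = r ^ n" using card by blast
        have "x [^]\<^bsub>perm_group P\<^esub> card P = \<one>\<^bsub>perm_group P\<^esub>"
          using P.pow_order_eq_1[of x] x by (simp add: Coset.order_def)
        then have "x ^^ (CARD('p) ^ n) = id"
          using nat_pow_consistent[of x "card P" P] n r by (simp add: pow_eq xG)
        then show ?thesis using p_element_funpow_eq_id[OF der xG] r by simp
      qed
      then show "group_exponent (perm_group P) = r"
        using sylow_exponent_prime_iff[OF assms(7) _ P] CARD_dvd_order r
          subgroup.mem_carrier[OF sub] by (simp add: pow_eq)
    qed
    ultimately show "?p \<and> ?two \<and> ?syl" using r by blast
  next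
    assume R: "?p \<and> ?two \<and> ?syl"
    then have r: "r = CARD('p)" by blast
    \<comment> \<open>Condition (ii) ranges over all Sylow subgroups, so one has to be exhibited
      before it yields information.\<close>
    obtain P where P: "sylow_subgroup r (perm_group G) P"
      using ex_sylow_subgroup[OF assms(7)] by auto
    then have kill: "x [^]\<^bsub>perm_group G\<^esub> r = \<one>\<^bsub>perm_group G\<^esub>" if "x \<in> P" for x
      using sylow_exponent_prime_iff[OF assms(7) _ P] CARD_dvd_order R that by simp
    show ?L
    proof (intro ballI impI)
      fix g assume g: "g \<in> G" "derangement UNIV (\<lambda>g. g) g"
      obtain n where "g ^^ (r ^ n) = id"
        using derangement_p_power[OF _ g] R by blast
      then have "g [^]\<^bsub>perm_group G\<^esub> r = \<one>\<^bsub>perm_group G\<^esub>"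
        using p_element_power_eq_one[OF assms(7) _ P kill, of g n] g(1) by (simp add: pow_eq)
      moreover have "g \<noteq> id" using g(2) by (auto simp: derangement_def)
      ultimately show "ord g = r" using g(1) assms(7) by (intro ord_eq_prime) (simp_all add: pow_eq)
    qed
  qed
qed

end
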